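(* There exist at least $10$ distinct sets $S$ of $12$ distinct MacMahon cubes that are universal, i.e. such that for every one of the $30$ MacMahon cubes $T$ there is a subset $W\subseteq S$ of eight cubes whose solution number for $T$ is positive.
   Context: A MacMahon cube is a cube whose six faces are painted with the six colors $1,\dots,6$, each color used on exactly one face, considered up to rotation; there are exactly $30$ MacMahon cubes. At each vertex of a cube three faces meet; reading their colors clockwise as seen from outside gives a cyclic triple, and the corner number of that vertex is the cyclic rotation of this triple with smallest three-digit value. Each MacMahon cube has $8$ distinct corner numbers. For a target MacMahon cube $T$ and a set $W$ of eight distinct MacMahon cubes, a solution is a bijection $\sigma$ from $W$ to the set of corner numbers of $T$ such that $\sigma(C)$ is a corner number of $C$ for every $C\in W$ (an arrangement of the eight cubes into a $2\times2\times2$ block whose exterior is colored like an enlarged $T$, with no condition on interior faces). The solution number of $W$ for $T$ is the number of such bijections. *)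

theory Defs
  imports Main "HOL-Library.FuncSet"
begin

datatype face = Up | Down | Front | Back | Left | Right

text \<open>Each of these permutations of the faces is the effect of a quarter turn of the cube about
  one of its three axes.\<close>

fun turn_vertical :: "face \<Rightarrow> face" where
  "turn_vertical Front = Left"
| "turn_vertical Left = Back"
| "turn_vertical Back = Right"
| "turn_vertical Right = Front"
| "turn_vertical Up = Up"
| "turn_vertical Down = Down"

fun turn_left_right :: "face \<Rightarrow> face" where
  "turn_left_right Up = Front"
| "turn_left_right Front = Down"
| "turn_left_right Down = Back"
| "turn_left_right Back = Up"
| "turn_left_right Left = Left"
| "turn_left_right Right = Right"

fun turn_front_back :: "face \<Rightarrow> face" where
  "turn_front_back Up = Right"
| "turn_front_back Right = Down"
| "turn_front_back Down = Left"
| "turn_front_back Left = Up"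
| "turn_front_back Front = Front"
| "turn_front_back Back = Back"

inductive_set rotations :: "(face \<Rightarrow> face) set" where
  "id \<in> rotations"
| "r \<in> rotations \<Longrightarrow> r \<circ> turn_vertical \<in> rotations"
| "r \<in> rotations \<Longrightarrow> r \<circ> turn_left_right \<in> rotations"
| "r \<in> rotations \<Longrightarrow> r \<circ> turn_front_back \<in> rotations"

definition colorings :: "(face \<Rightarrow> nat) set" where
  "colorings = {c. bij_betw c UNIV {1..6}}"

definition same_cube :: "((face \<Rightarrow> nat) \<times> (face \<Rightarrow> nat)) set" where
  "same_cube = {(c, d). c \<in> colorings \<and> d \<in> colorings \<and> (\<exists>r\<in>rotations. d = c \<circ> r)}"

type_synonym cube = "(face \<Rightarrow> nat) set"

definition macmahon_cubes :: "cube set" where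
  "macmahon_cubes = colorings // same_cube"

text \<open>The eight vertices, each given by its three faces in clockwise order as seen from outside
  (front face towards the viewer, left and right being the viewer's).\<close>

definition vertices :: "(face \<times> face \<times> face) set" where
  "vertices =
    {(Up, Right, Front), (Up, Front, Left), (Up, Left, Back), (Up, Back, Right),
     (Down, Front, Right), (Down, Left, Front), (Down, Back, Left), (Down, Right, Back)}"

definition corner_number :: "nat \<Rightarrow> nat \<Rightarrow> nat \<Rightarrow> nat" where
  "corner_number i j k =
    Min {100 * i + 10 * j + k, 100 * j + 10 * k + i, 100 * k + 10 * i + j}"

definition coloring_corner_numbers :: "(face \<Rightarrow> nat) \<Rightarrow> nat set" where
  "coloring_corner_numbers c = (\<lambda>(x, y, z). corner_number (c x) (c y) (c z)) ` vertices"

lemma corner_number_rotate: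
  "corner_number j k i = corner_number i j k" "corner_number k i j = corner_number i j k"
  by (simp_all add: corner_number_def insert_commute)

lemma coloring_corner_numbers_rotate:
  assumes "r \<in> rotations"
  shows "coloring_corner_numbers (c \<circ> r) = coloring_corner_numbers c"
  using assms
proof (induction r rule: rotations.induct)
qed (auto simp: coloring_corner_numbers_def vertices_def corner_number_rotate)

text \<open>By the preceding lemma all colorings in a cube have the same corner numbers, so this union
  is the common value.\<close>

definition corner_numbers :: "cube \<Rightarrow> nat set" where
  "corner_numbers C = (\<Union>c\<in>C. coloring_corner_numbers c)"

text \<open>Solutions are extensional functions, so that they are counted without regard to values
  outside \<open>W\<close>.\<close>

definition solutions :: "cube set \<Rightarrow> cube \<Rightarrow> (cube \<Rightarrow> nat) set" where
  "solutions W T = {\<sigma> \<in> extensional W.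
     bij_betw \<sigma> W (corner_numbers T) \<and> (\<forall>C\<in>W. \<sigma> C \<in> corner_numbers C)}"

definition solution_number :: "cube set \<Rightarrow> cube \<Rightarrow> nat" where
  "solution_number W T = card (solutions W T)"

definition universal :: "cube set \<Rightarrow> bool" where
  "universal S \<longleftrightarrow>
     (\<forall>T\<in>macmahon_cubes. \<exists>W\<subseteq>S. card W = 8 \<and> solution_number W T > 0)"

end

theory Submission
  imports Defs
begin

text \<open>Fix a set \<open>A\<close> of three colors. In twelve cubes, every pair of opposite faces has exactly one
  color in \<open>A\<close>; they form a universal set, and the ten choices of \<open>A\<close> with \<open>1 \<in> A\<close> give ten
  different sets. To see universality, consider a target cube \<open>T\<close>. For each vertex of \<open>T\<close>, keep the
  three colors around it and permute the other three so that opposite faces become separated by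
  \<open>A\<close>. Up to rotation there are only two ways in which the three faces of \<open>T\<close> with colors in \<open>A\<close>
  can lie: around a vertex, or as two opposite faces and one between them. In both cases the
  permutations can be chosen so that the eight resulting cubes are distinct.\<close>

section \<open>Rotations\<close>

fun opposite :: "face \<Rightarrow> face" where
  "opposite Up = Down"
| "opposite Down = Up"
| "opposite Front = Back"
| "opposite Back = Front"
| "opposite Left = Right"
| "opposite Right = Left"

text \<open>The 24 clockwise face triples around the vertices, with every choice of first face. A
  vertex alone leaves three rotations open; a flag pins down one.\<close>

definition flags :: "(face \<times> face \<times> face) set" where
  "flags = vertices \<union> (\<lambda>(x, y, z). (y, z, x)) ` vertices \<union> (\<lambda>(x, y, z). (z, x, y)) ` vertices"

lemma UNIV_face: "UNIV = {Up, Down, Front, Back, Left, Right}"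
  using face.exhaust by blast

lemma all_face: "(\<forall>x. P x) \<longleftrightarrow> P Up \<and> P Down \<and> P Front \<and> P Back \<and> P Left \<and> P Right"
  by (metis face.exhaust)

lemma ex_face: "(\<exists>x. P x) \<longleftrightarrow> P Up \<or> P Down \<or> P Front \<or> P Back \<or> P Left \<or> P Right"
  by (metis face.exhaust)

lemma finite_UNIV_face: "finite (UNIV :: face set)"
  by (simp add: UNIV_face)

lemma bij_turns: "bij turn_vertical" "bij turn_left_right" "bij turn_front_back"
  by (simp_all add: bij_def inj_def surj_def all_face ex_face)

lemma bij_rotation: "r \<in> rotations \<Longrightarrow> bij r"
  by (induction rule: rotations.induct) (blast intro: bij_id bij_comp bij_turns)+

lemma rotation_comp:
  assumes "r \<in> rotations" "s \<in> rotations"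
  shows "r \<circ> s \<in> rotations"
  using assms(2,1)
  by (induction s rule: rotations.induct) (auto intro: rotations.intros simp flip: comp_assoc)

lemma turns_in_rotations:
  "turn_vertical \<in> rotations" "turn_left_right \<in> rotations" "turn_front_back \<in> rotations"
  using rotations.intros(2-4)[OF rotations.intros(1)] by simp_all

lemma turn_inverse:
  "turn_vertical \<circ> (turn_vertical \<circ> (turn_vertical \<circ> turn_vertical)) = id"
  "turn_left_right \<circ> (turn_left_right \<circ> (turn_left_right \<circ> turn_left_right)) = id"
  "turn_front_back \<circ> (turn_front_back \<circ> (turn_front_back \<circ> turn_front_back)) = id"
  by (simp_all add: fun_eq_iff all_face)

text \<open>A quarter turn has order four, so its third power is its inverse. If \<open>s\<close>
  inverts \<open>r\<close>, then the third power of \<open>t\<close> composed with \<open>s\<close>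
  inverts \<open>r \<circ> t\<close>.\<close>

lemma rotation_inverse:
  assumes "r \<in> rotations"
  shows "\<exists>s\<in>rotations. r \<circ> s = id"
proof -
  have step: "\<exists>s\<in>rotations. (r \<circ> t) \<circ> s = id"
    if "t \<in> rotations" "t \<circ> (t \<circ> (t \<circ> t)) = id" "s \<in> rotations" "r \<circ> s = id" for r s t
  proof
    show "t \<circ> (t \<circ> t) \<circ> s \<in> rotations"
      using that by (intro rotation_comp)
    have "(r \<circ> t) \<circ> (t \<circ> (t \<circ> t) \<circ> s) = r \<circ> (t \<circ> (t \<circ> (t \<circ> t))) \<circ> s"
      by (simp add: comp_assoc)
    then show "(r \<circ> t) \<circ> (t \<circ> (t \<circ> t) \<circ> s) = id"
      using that by simp
  qed
  show ?thesis
    using assms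
  proof (induction r rule: rotations.induct)
    case 1
    then show ?case
      using rotations.intros(1) comp_id by blast
  qed (use step turns_in_rotations turn_inverse in blast)+
qed

lemma rotation_opposite: "r \<in> rotations \<Longrightarrow> r (opposite x) = opposite (r x)"
proof (induction arbitrary: x rule: rotations.induct)
  case 1
  show ?case by simp
next
  case (2 r)
  have "turn_vertical (opposite x) = opposite (turn_vertical x)" by (cases x) simp_all
  with 2 show ?case by simp
next
  case (3 r)
  have "turn_left_right (opposite x) = opposite (turn_left_right x)" by (cases x) simp_all
  with 3 show ?case by simp
next
  case (4 r)
  have "turn_front_back (opposite x) = opposite (turn_front_back x)" by (cases x) simp_all
  with 4 show ?case by simp
qed

section \<open>Action of the rotations on flags\<close>

lemma flags_eq:
  "flags = set
    [(Up, Right, Front), (Up, Front, Left), (Up, Left, Back), (Up, Back, Right),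
     (Down, Front, Right), (Down, Left, Front), (Down, Back, Left), (Down, Right, Back),
     (Right, Front, Up), (Front, Left, Up), (Left, Back, Up), (Back, Right, Up),
     (Front, Right, Down), (Left, Front, Down), (Back, Left, Down), (Right, Back, Down),
     (Front, Up, Right), (Left, Up, Front), (Back, Up, Left), (Right, Up, Back),
     (Right, Down, Front), (Front, Down, Left), (Left, Down, Back), (Back, Down, Right)]"
  unfolding flags_def vertices_def image_insert image_empty Un_insert_left Un_empty_left Un_assoc
    prod.case list.set
  by (rule refl)

text \<open>An invariant of a labelling of the faces under rotation. It serves to show that two
  labellings do not differ by a rotation.\<close>

abbreviation map_flags :: "(face \<Rightarrow> 'a) \<Rightarrow> ('a \<times> 'a \<times> 'a) set" where
  "map_flags f \<equiv> (\<lambda>(x, y, z). (f x, f y, f z)) ` flags"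

lemma map_flags_turn:
  "map_flags turn_vertical = flags"
  "map_flags turn_left_right = flags"
  "map_flags turn_front_back = flags"
  unfolding flags_eq by code_simp+

text \<open>Each quarter turn permutes the flags, so composing with it only reindexes the
  image.\<close>

lemma map_flags_rotation:
  assumes "r \<in> rotations"
  shows "map_flags (f \<circ> r) = map_flags f"
proof -
  have step: "map_flags (f \<circ> (r \<circ> t)) = map_flags f"
    if "map_flags t = flags" "map_flags (f \<circ> r) = map_flags f" for r t :: "face \<Rightarrow> face"
  proof -
    have "map_flags (f \<circ> (r \<circ> t)) = (\<lambda>(x, y, z). ((f \<circ> r) x, (f \<circ> r) y, (f \<circ> r) z)) ` map_flags t"
      by (simp add: image_image case_prod_unfold)
    with that show ?thesis by simp
  qed
  show ?thesis
    using assms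
    by (induction r rule: rotations.induct) (simp, (rule step, rule map_flags_turn, assumption)+)
qed

lemma rotation_flags:
  assumes "r \<in> rotations" "(x, y, z) \<in> flags"
  shows "(r x, r y, r z) \<in> flags"
  using map_flags_rotation[OF assms(1), of id] assms(2) by force

lemma rotations_transitive:
  assumes "(x, y, z) \<in> flags"
  obtains r where "r \<in> rotations" "r Up = x" "r Right = y" "r Front = z"
proof -
  let ?v = turn_vertical and ?l = turn_left_right and ?f = turn_front_back
  \<comment> \<open>The six choices of \<open>s\<close> take \<open>Up\<close> to the six faces. The
    powers of \<open>turn_vertical\<close> fix \<open>Up\<close>, so \<open>t\<close> then selects
    one of the four flags starting with \<open>x\<close>.\<close>
  have "\<exists>s \<in> {id, ?l, ?l \<circ> ?l, ?l \<circ> (?l \<circ> ?l), ?f, ?f \<circ> (?f \<circ> ?f)}.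
      \<exists>t \<in> {id, ?v, ?v \<circ> ?v, ?v \<circ> (?v \<circ> ?v)}.
        (s \<circ> t) Up = x \<and> (s \<circ> t) Right = y \<and> (s \<circ> t) Front = z"
    using assms unfolding flags_eq list.set by (elim insertE emptyE) simp_all
  moreover have "{id, ?l, ?l \<circ> ?l, ?l \<circ> (?l \<circ> ?l), ?f, ?f \<circ> (?f \<circ> ?f)} \<subseteq> rotations"
      "{id, ?v, ?v \<circ> ?v, ?v \<circ> (?v \<circ> ?v)} \<subseteq> rotations"
    by (auto intro!: rotation_comp turns_in_rotations rotations.intros(1))
  ultimately show thesis
    using rotation_comp that by (meson subsetD)
qed

section \<open>Cubes separated by a set of colors\<close>

abbreviation cube_of :: "(face \<Rightarrow> nat) \<Rightarrow> cube" where
  "cube_of c \<equiv> same_cube `` {c}"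

definition split_colorings :: "nat set \<Rightarrow> (face \<Rightarrow> nat) set" where
  "split_colorings A = {c \<in> colorings. \<forall>x. c (opposite x) \<in> A \<longleftrightarrow> c x \<notin> A}"

definition split_cubes :: "nat set \<Rightarrow> cube set" where
  "split_cubes A = cube_of ` split_colorings A"

lemma coloring_comp: "c \<in> colorings \<Longrightarrow> bij p \<Longrightarrow> c \<circ> p \<in> colorings"
  unfolding colorings_def by (auto intro: bij_betw_trans)

lemma inj_coloring: "c \<in> colorings \<Longrightarrow> inj c"
  by (simp add: colorings_def bij_betw_def)

lemma in_cube_of: "d \<in> cube_of c \<longleftrightarrow> c \<in> colorings \<and> (\<exists>r\<in>rotations. d = c \<circ> r)"
  using coloring_comp bij_rotation by (auto simp: same_cube_def)

lemma equiv_same_cube: "equiv colorings same_cube"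
proof (rule equivI)
  show "refl_on colorings same_cube"
    by (auto simp: refl_on_def same_cube_def intro!: bexI[of _ id] rotations.intros(1))
  show "same_cube \<subseteq> colorings \<times> colorings"
    by (auto simp: same_cube_def)
  show "sym same_cube"
  proof (rule symI)
    fix c d assume cd: "(c, d) \<in> same_cube"
    then obtain r where r: "r \<in> rotations" "d = c \<circ> r"
      by (auto simp: same_cube_def)
    obtain s where s: "s \<in> rotations" "r \<circ> s = id"
      using rotation_inverse[OF r(1)] by blast
    have "d \<circ> s = c"
      using r s by (simp add: comp_assoc)
    with s(1) cd show "(d, c) \<in> same_cube"
      by (auto simp: same_cube_def)
  qed
  show "trans same_cube"
    by (rule transI) (auto simp: same_cube_def comp_assoc intro: rotation_comp)
qed

lemma cube_of_eq_iff:
  assumes "c \<in> colorings" "d \<in> colorings"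
  shows "cube_of c = cube_of d \<longleftrightarrow> (\<exists>r\<in>rotations. d = c \<circ> r)"
  using eq_equiv_class_iff[OF equiv_same_cube assms] assms by (auto simp: same_cube_def)

lemma macmahon_cubes_eq: "macmahon_cubes = cube_of ` colorings"
  by (auto simp: macmahon_cubes_def quotient_def)

lemma split_coloring_opposite: "c \<in> split_colorings A \<Longrightarrow> c (opposite x) \<in> A \<longleftrightarrow> c x \<notin> A"
  by (simp add: split_colorings_def)

lemma split_coloring_rotation:
  assumes "c \<in> split_colorings A" "r \<in> rotations"
  shows "c \<circ> r \<in> split_colorings A"
  using assms by (simp add: split_colorings_def rotation_opposite[OF assms(2)] coloring_comp bij_rotation)

text \<open>Separation by \<open>A\<close> is invariant under rotation, so each cube in the family
  consists of separated colorings only.\<close>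

lemma Union_split_cubes: "\<Union>(split_cubes A) = split_colorings A"
proof
  show "\<Union>(split_cubes A) \<subseteq> split_colorings A"
  proof
    fix d assume "d \<in> \<Union>(split_cubes A)"
    then obtain c where "c \<in> split_colorings A" "d \<in> cube_of c"
      by (auto simp: split_cubes_def)
    then show "d \<in> split_colorings A"
      unfolding in_cube_of using split_coloring_rotation by auto
  qed
  show "split_colorings A \<subseteq> \<Union>(split_cubes A)"
    using equiv_class_self[OF equiv_same_cube] by (auto simp: split_cubes_def split_colorings_def)
qed

lemma split_cubes_subset: "split_cubes A \<subseteq> macmahon_cubes"
  by (auto simp: split_cubes_def split_colorings_def macmahon_cubes_eq)

section \<open>Sets of three faces\<close>

text \<open>Replaces a set of faces by one of 64 concrete lists, so that statements about all sets
  of faces can be decided by evaluation.\<close>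

lemma faces_subseq:
  obtains fs where "fs \<in> set (subseqs [Up, Down, Front, Back, Left, Right])" "distinct fs"
    "F = set fs"
proof -
  let ?faces = "[Up, Down, Front, Back, Left, Right]"
  have "F \<in> Pow (set ?faces)"
    using UNIV_face by auto
  then obtain fs where "fs \<in> set (subseqs ?faces)" "F = set fs"
    unfolding subseqs_powset[symmetric] by blast
  moreover from this have "distinct fs"
    by (intro subseqs_distinctD[of fs ?faces]) simp_all
  ultimately show thesis
    using that by blast
qed

text \<open>Choosing one face from each opposite pair is the same as choosing a vertex; reading
  clockwise from \<open>x\<close> gives the flag.\<close>

lemma split_faces_at_vertex:
  assumes "\<forall>x. opposite x \<in> F \<longleftrightarrow> x \<notin> F" "x \<in> F"
  obtains y z where "(x, y, z) \<in> flags" "F = {x, y, z}"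
proof -
  let ?faces = "[Up, Down, Front, Back, Left, Right]"
  have *: "\<forall>fs\<in>set (subseqs ?faces). (\<forall>x\<in>set ?faces. opposite x \<in> set fs \<longleftrightarrow> x \<notin> set fs) \<longrightarrow>
      (\<forall>x\<in>set fs. \<exists>(x', y, z)\<in>flags. x' = x \<and> set fs = {x, y, z})"
    unfolding flags_eq by code_simp
  obtain fs where fs: "fs \<in> set (subseqs ?faces)" "F = set fs"
    by (rule faces_subseq)
  from *[rule_format, OF fs(1), of x] assms that show thesis
    unfolding fs(2) by blast
qed

text \<open>Three faces either contain no opposite pair and meet at a vertex, or consist of an
  opposite pair and a face adjacent to both. Both cases are described through a flag so that one
  rotation brings them to standard position.\<close>

lemma three_faces:
  assumes "card F = 3"
  obtains x y z where "(x, y, z) \<in> flags" "F = {x, y, z} \<or> F = {y, opposite y, x}"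
proof -
  let ?faces = "[Up, Down, Front, Back, Left, Right]"
  have *: "\<forall>fs\<in>set (subseqs ?faces). length fs = 3 \<longrightarrow>
      (\<exists>(x, y, z)\<in>flags. set fs = {x, y, z} \<or> set fs = {y, opposite y, x})"
    unfolding flags_eq by code_simp
  obtain fs where fs: "fs \<in> set (subseqs ?faces)" "distinct fs" "F = set fs"
    by (rule faces_subseq)
  then have "length fs = 3"
    using assms distinct_card by metis
  from *[rule_format, OF fs(1) this] that show thesis
    unfolding fs(3) by blast
qed

section \<open>Counting the separated cubes\<close>

text \<open>Polymorphic because it writes down both colorings and permutations of the faces.\<close>

fun paint :: "'a \<Rightarrow> 'a \<Rightarrow> 'a \<Rightarrow> 'a \<Rightarrow> 'a \<Rightarrow> 'a \<Rightarrow> face \<Rightarrow> 'a" where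
  "paint u d f b l r Up = u"
| "paint u d f b l r Down = d"
| "paint u d f b l r Front = f"
| "paint u d f b l r Back = b"
| "paint u d f b l r Left = l"
| "paint u d f b l r Right = r"

lemma paint_eq_iff: "paint u d f b l r = c \<longleftrightarrow>
    c Up = u \<and> c Down = d \<and> c Front = f \<and> c Back = b \<and> c Left = l \<and> c Right = r"
  by (auto simp: fun_eq_iff all_face)

lemma paint_in_split_colorings:
  assumes "distinct [u, r, f, d, b, l]" "{1..6} = set [u, r, f, d, b, l]"
  shows "paint u d f b l r \<in> split_colorings {u, r, f}"
proof -
  have "inj (paint u d f b l r)"
    using assms(1) by (simp add: inj_def all_face eq_commute)
  moreover have "range (paint u d f b l r) = {1..6}"
    unfolding assms(2) UNIV_face by auto
  moreover have "\<forall>x. paint u d f b l r (opposite x) \<in> {u, r, f} \<longleftrightarrow> paint u d f b l r x \<notin> {u, r, f}"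
    using assms(1) by (simp add: all_face eq_commute)
  ultimately show ?thesis
    by (simp add: split_colorings_def colorings_def bij_betw_def)
qed

text \<open>Normal forms for \<open>a \<in> A\<close>: the faces with colors in \<open>A\<close>
  meet at a vertex, which is rotated to \<open>Up\<close>, \<open>Right\<close>,
  \<open>Front\<close> with \<open>a\<close> on top.\<close>

definition split_representatives :: "nat set \<Rightarrow> nat \<Rightarrow> (face \<Rightarrow> nat) set" where
  "split_representatives A a =
    {c \<in> split_colorings A. c Up = a \<and> c Right \<in> A \<and> c Front \<in> A}"

lemma split_cubes_eq_representatives:
  assumes "a \<in> A" "A \<subseteq> {1..6}"
  shows "split_cubes A = cube_of ` split_representatives A a"
proof
  show "cube_of ` split_representatives A a \<subseteq> split_cubes A"
    by (auto simp: split_cubes_def split_representatives_def)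
  show "split_cubes A \<subseteq> cube_of ` split_representatives A a"
    unfolding split_cubes_def
  proof (rule image_subsetI)
    fix c assume c: "c \<in> split_colorings A"
    then have col: "c \<in> colorings" and split: "\<forall>x. opposite x \<in> c -` A \<longleftrightarrow> x \<notin> c -` A"
      by (auto simp: split_colorings_def)
    have "a \<in> range c"
      using col assms unfolding colorings_def bij_betw_def by blast
    then obtain x where x: "c x = a"
      by blast
    then obtain y z where yz: "(x, y, z) \<in> flags" "c -` A = {x, y, z}"
      using split_faces_at_vertex[OF split] assms by blast
    obtain r where r: "r \<in> rotations" "r Up = x" "r Right = y" "r Front = z"
      using rotations_transitive[OF yz(1)] .
    have "c \<circ> r \<in> split_representatives A a"
      using split_coloring_rotation[OF c r(1)] x yz(2) r by (simp add: split_representatives_def) blast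
    moreover have "cube_of c = cube_of (c \<circ> r)"
      using cube_of_eq_iff[OF col coloring_comp[OF col bij_rotation[OF r(1)]]] r(1) by blast
    ultimately show "cube_of c \<in> cube_of ` split_representatives A a"
      by blast
  qed
qed

text \<open>A rotation relating two normal forms fixes \<open>Up\<close> and sends
  \<open>Right\<close> and \<open>Front\<close> to faces with colors in \<open>A\<close>, hence not
  to \<open>Left\<close> or \<open>Back\<close>. The only such flag starting with \<open>Up\<close>
  is \<open>(Up, Right, Front)\<close>, so the rotation is the identity.\<close>

lemma inj_on_cube_of_representatives:
  "inj_on cube_of (split_representatives A a)"
proof (rule inj_onI)
  fix c d assume c: "c \<in> split_representatives A a" and d: "d \<in> split_representatives A a"
    and eq: "cube_of c = cube_of d"
  have col: "c \<in> colorings" "d \<in> colorings"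
    using c d by (auto simp: split_representatives_def split_colorings_def)
  obtain r where r: "r \<in> rotations" "d = c \<circ> r"
    using eq cube_of_eq_iff[OF col] by blast
  have "c (r Up) = c Up"
    using c d r by (simp add: split_representatives_def)
  then have up: "r Up = Up"
    using inj_coloring[OF col(1)] by (simp add: inj_eq)
  have "c Left \<notin> A" "c Back \<notin> A" "c (r Right) \<in> A" "c (r Front) \<in> A"
    using c d r split_coloring_opposite[of c A Right] split_coloring_opposite[of c A Front]
    by (simp_all add: split_representatives_def)
  moreover have "(Up, r Right, r Front) \<in> flags"
    using rotation_flags[OF r(1), of Up Right Front] up by (simp add: flags_eq)
  ultimately have "r Right = Right" "r Front = Front"
    by (auto simp: flags_eq)
  then have "r = id"
    using up rotation_opposite[OF r(1), of Up] rotation_opposite[OF r(1), of Right]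
      rotation_opposite[OF r(1), of Front]
    by (simp add: fun_eq_iff all_face)
  with r show "c = d" by simp
qed

lemma orderings_of_three:
  assumes "x \<in> {p, q, s}" "y \<in> {p, q, s}" "z \<in> {p, q, s}" "x \<noteq> y" "x \<noteq> z" "y \<noteq> z"
  shows "(x, y, z) \<in> {(p, q, s), (p, s, q), (q, p, s), (q, s, p), (s, p, q), (s, q, p)}"
  using assms by (elim insertE emptyE) simp_all

text \<open>The other two colors of \<open>A\<close> can be placed on \<open>Right\<close> and
  \<open>Front\<close> in 2 ways, the three colors outside \<open>A\<close> on the remaining faces
  in 6 ways.\<close>

lemma card_split_representatives:
  assumes "a \<in> A" "A \<subseteq> {1..6}" "card A = 3"
  shows "card (split_representatives A a) = 12"
proof -
  have "card (A - {a}) = 2" "card ({1..6} - A) = 3"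
    using assms by (simp_all add: card_Diff_subset finite_subset)
  then obtain b c p q s where bc: "A - {a} = {b, c}" "b \<noteq> c"
    and pqs: "{1..6} - A = {p, q, s}" "p \<noteq> q" "p \<noteq> s" "q \<noteq> s"
    by (auto simp: card_2_iff card_3_iff)
  have A: "A = {a, b, c}" "a \<noteq> b" "a \<noteq> c"
    using bc assms(1) by auto
  have univ: "{1..6} = {a, b, c, p, q, s}"
    using A(1) pqs(1) assms(2) by blast
  have neq: "p \<notin> {a, b, c}" "q \<notin> {a, b, c}" "s \<notin> {a, b, c}"
    using pqs(1) A(1) by auto
  let ?K = "{(b, c), (c, b)} \<times>
    {(p, q, s), (p, s, q), (q, p, s), (q, s, p), (s, p, q), (s, q, p)}"
  let ?f = "\<lambda>((r, f), (d, k, l)). paint a d f k l r"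
  have "split_representatives A a = ?f ` ?K"
  proof
    show "?f ` ?K \<subseteq> split_representatives A a"
    proof (rule image_subsetI)
      fix t assume t: "t \<in> ?K"
      obtain r f d k l where t_eq: "t = ((r, f), (d, k, l))"
        by (metis surj_pair)
      have "distinct [a, r, f, d, k, l]" "{1..6} = set [a, r, f, d, k, l]" "A = {a, r, f}"
        using t bc(2) pqs A neq unfolding t_eq univ by auto
      then show "?f t \<in> split_representatives A a"
        using paint_in_split_colorings[of a r f d k l]
        by (simp add: t_eq split_representatives_def)
    qed
    show "split_representatives A a \<subseteq> ?f ` ?K"
    proof
      fix e assume e: "e \<in> split_representatives A a"
      then have col: "e \<in> colorings" and mem: "e Up = a" "e Right \<in> A" "e Front \<in> A"
          "e Down \<notin> A" "e Back \<notin> A" "e Left \<notin> A"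
        using assms(1) split_coloring_opposite[of e A Up] split_coloring_opposite[of e A Right]
          split_coloring_opposite[of e A Front]
        by (simp_all add: split_representatives_def split_colorings_def)
      have ran: "e x \<in> {a, b, c, p, q, s}" for x
        using col by (auto simp: colorings_def bij_betw_def simp flip: univ)
      have inj: "e x = e y \<longleftrightarrow> x = y" for x y
        using inj_coloring[OF col] by (simp add: inj_eq)
      have "e Right \<in> {b, c}" "e Front \<in> {b, c}" "e Right \<noteq> e Front"
        using mem inj[of Up Right] inj[of Up Front] by (auto simp: A(1) inj)
      then have 1: "(e Right, e Front) \<in> {(b, c), (c, b)}"
        by auto
      have "e Down \<in> {p, q, s}" "e Back \<in> {p, q, s}" "e Left \<in> {p, q, s}"
        using mem ran[of Down] ran[of Back] ran[of Left] by (auto simp: A(1))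
      moreover have "e Down \<noteq> e Back" "e Down \<noteq> e Left" "e Back \<noteq> e Left"
        by (simp_all add: inj)
      ultimately have 2: "(e Down, e Back, e Left) \<in>
          {(p, q, s), (p, s, q), (q, p, s), (q, s, p), (s, p, q), (s, q, p)}"
        by (rule orderings_of_three)
      have "e = ?f ((e Right, e Front), (e Down, e Back, e Left))"
        by (simp add: mem fun_eq_iff all_face)
      with 1 2 show "e \<in> ?f ` ?K"
        by blast
    qed
  qed
  moreover have "inj_on ?f ?K"
    by (rule inj_on_subset[of _ UNIV]) (auto simp: inj_def paint_eq_iff)
  moreover have "card ?K = 12"
    unfolding card_cartesian_product using bc(2) pqs(2-4) by simp
  ultimately show ?thesis
    by (simp only: card_image)
qed

lemma card_split_cubes:
  assumes "A \<subseteq> {1..6}" "card A = 3"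
  shows "card (split_cubes A) = 12"
proof -
  obtain a where "a \<in> A"
    using assms(2) by fastforce
  then show ?thesis
    using assms by (simp add: split_cubes_eq_representatives card_image
        inj_on_cube_of_representatives card_split_representatives)
qed

text \<open>Shows that the family determines \<open>A\<close> once one color \<open>a\<close> of
  \<open>A\<close> is known; this separates the families for different \<open>A\<close>.\<close>

lemma colors_opposite_in_split_cubes:
  assumes "a \<in> A" "A \<subseteq> {1..6}" "card A = 3"
  shows "{c Down | c. c \<in> \<Union>(split_cubes A) \<and> c Up = a} = {1..6} - A"
proof -
  have "c Down \<in> {1..6} - A" if "c \<in> split_colorings A" "c Up = a" for c
    using that assms(1) split_coloring_opposite[of c A Up]
    by (auto simp: split_colorings_def colorings_def bij_betw_def)
  moreover have "\<exists>c\<in>split_colorings A. c Up = a \<and> c Down = p" if p: "p \<in> {1..6} - A" for p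
  proof -
    have "card (A - {a}) = 2" "card ({1..6} - A - {p}) = 2"
      using assms p by (simp_all add: card_Diff_subset finite_subset)
    then obtain b c q s where bc: "A - {a} = {b, c}" "b \<noteq> c"
      and qs: "{1..6} - A - {p} = {q, s}" "q \<noteq> s"
      by (auto simp: card_2_iff)
    have A: "A = {a, b, c}"
      using bc assms(1) by auto
    have "{1..6} = set [a, b, c, p, q, s]"
      using A qs(1) assms(2) p unfolding list.set by blast
    moreover have "distinct [a, b, c, p, q, s]"
      by (rule card_distinct, subst calculation[symmetric]) simp
    ultimately have "paint a p c q s b \<in> split_colorings A"
      unfolding A by (intro paint_in_split_colorings)
    then show ?thesis
      by (rule bexI[rotated]) simp
  qed
  ultimately show ?thesis
    unfolding Union_split_cubes by blast
qed

section \<open>Universality\<close>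

text \<open>Whichever of the three cyclic readings is the minimum, its decimal digits are the same
  three colors.\<close>

lemma corner_number_digits:
  assumes "i < 10" "j < 10" "k < 10"
  shows "(\<lambda>n. {n div 100, n div 10 mod 10, n mod 10}) (corner_number i j k) = {i, j, k}"
proof -
  have digits: "{n div 100, n div 10 mod 10, n mod 10} = {i, j, k}"
    if "n = 100 * i + 10 * j + k" "i < 10" "j < 10" "k < 10" for n i j k :: nat
  proof -
    have "n div 100 = i" "n div 10 = 10 * i + j"
      using that by (auto intro!: div_nat_eqI)
    moreover have "n mod 10 = k" "(10 * i + j) mod 10 = j"
      using that mod_mult_self4[of 10 "10 * i + j" k] by (simp_all add: algebra_simps)
    ultimately show ?thesis by simp
  qed
  have "corner_number i j k \<in>
      {100 * i + 10 * j + k, 100 * j + 10 * k + i, 100 * k + 10 * i + j}"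
    unfolding corner_number_def by (rule Min_in) auto
  moreover have "{i, j, k} = {j, k, i}" "{i, j, k} = {k, i, j}"
    by blast+
  ultimately show ?thesis
    using digits[OF _ assms(1,2,3)] digits[OF _ assms(2,3,1)] digits[OF _ assms(3,1,2)]
    unfolding insert_iff empty_iff by metis
qed

lemma corner_numbers_cube_of:
  assumes "c \<in> colorings"
  shows "corner_numbers (cube_of c) = coloring_corner_numbers c"
proof -
  have "coloring_corner_numbers d = coloring_corner_numbers c" if "d \<in> cube_of c" for d
    using that coloring_corner_numbers_rotate unfolding in_cube_of by auto
  moreover have "c \<in> cube_of c"
    using equiv_class_self[OF equiv_same_cube assms] .
  ultimately show ?thesis
    unfolding corner_numbers_def by blast
qed

text \<open>The digits give the set of colors at the vertex, injectivity of \<open>c\<close> turns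
  it into the set of faces, and distinct vertices have distinct sets of faces.\<close>

lemma inj_on_corner_number_vertices:
  assumes "c \<in> colorings"
  shows "inj_on (\<lambda>(x, y, z). corner_number (c x) (c y) (c z)) vertices"
proof -
  have "c x < 10" for x
    using bij_betwE[OF assms[unfolded colorings_def mem_Collect_eq], rule_format, of x] by simp
  then have digits: "(\<lambda>n. {n div 100, n div 10 mod 10, n mod 10}) (corner_number (c x) (c y) (c z))
      = c ` {x, y, z}" for x y z
    by (subst corner_number_digits) auto
  have "{x, y, z} = {x', y', z'}"
    if "corner_number (c x) (c y) (c z) = corner_number (c x') (c y') (c z')" for x y z x' y' z'
    using arg_cong[OF that, of "\<lambda>n. {n div 100, n div 10 mod 10, n mod 10}"]
    unfolding digits using inj_coloring[OF assms] by (simp only: inj_image_eq_iff)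
  moreover have "inj_on (\<lambda>(x, y, z). {x, y, z}) vertices"
    unfolding inj_on_def vertices_def by code_simp
  ultimately show ?thesis
    unfolding inj_on_def by fast
qed

section \<open>Solutions from twists of the target\<close>

text \<open>The cube placed at vertex \<open>v\<close> is \<open>c \<circ> \<pi> v\<close>. As
  \<open>\<pi> v\<close> fixes the faces around \<open>v\<close>, this cube has the corner number
  required there. If two of these cubes coincided, their permutations would differ by a rotation and
  have equal \<open>map_flags\<close>.\<close>

lemma split_solution:
  assumes c: "c \<in> colorings"
    and bij: "\<And>v. v \<in> vertices \<Longrightarrow> bij (\<pi> v)"
    and split: "\<And>v. v \<in> vertices \<Longrightarrow> c \<circ> \<pi> v \<in> split_colorings A"
    and fixed: "\<And>x y z. (x, y, z) \<in> vertices \<Longrightarrow>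
      \<pi> (x, y, z) x = x \<and> \<pi> (x, y, z) y = y \<and> \<pi> (x, y, z) z = z"
    and flags_inj: "inj_on (\<lambda>v. map_flags (\<pi> v)) vertices"
  shows "\<exists>W\<subseteq>split_cubes A. card W = 8 \<and> solution_number W (cube_of c) > 0"
proof (intro exI conjI)
  define g where "g v = cube_of (c \<circ> \<pi> v)" for v
  define h where "h = (\<lambda>(x, y, z). corner_number (c x) (c y) (c z))"
  define \<sigma> where "\<sigma> = restrict (h \<circ> inv_into vertices g) (g ` vertices)"
  have col: "c \<circ> \<pi> v \<in> colorings" if "v \<in> vertices" for v
    using coloring_comp[OF c bij[OF that]] .
  have inj_g: "inj_on g vertices"
  proof (rule inj_onI)
    fix v w assume vw: "v \<in> vertices" "w \<in> vertices" "g v = g w"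
    then obtain r where r: "r \<in> rotations" "c \<circ> \<pi> w = c \<circ> \<pi> v \<circ> r"
      using cube_of_eq_iff[OF col col] unfolding g_def by blast
    \<comment> \<open>Cancelling the injective \<open>c\<close> makes the question independent of
      the colors.\<close>
    have "\<pi> w = \<pi> v \<circ> r"
      using r(2) inj_coloring[OF c] by (auto simp: fun_eq_iff inj_eq)
    then have "map_flags (\<pi> w) = map_flags (\<pi> v)"
      using map_flags_rotation[OF r(1)] by simp
    then show "v = w"
      using flags_inj vw by (auto dest: inj_onD)
  qed
  have h_image: "h ` vertices = corner_numbers (cube_of c)"
    by (simp add: h_def corner_numbers_cube_of[OF c] coloring_corner_numbers_def)
  have fin: "finite vertices" "card vertices = 8"
    by (simp_all add: vertices_def)
  show "g ` vertices \<subseteq> split_cubes A"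
    using split by (auto simp: g_def split_cubes_def)
  show "card (g ` vertices) = 8"
    using card_image[OF inj_g] fin by simp
  have "bij_betw (h \<circ> inv_into vertices g) (g ` vertices) (corner_numbers (cube_of c))"
  proof (rule bij_betw_trans)
    show "bij_betw (inv_into vertices g) (g ` vertices) vertices"
      using inj_g by (simp add: bij_betw_inv_into inj_on_imp_bij_betw)
    show "bij_betw h vertices (corner_numbers (cube_of c))"
      using inj_on_corner_number_vertices[OF c] h_image by (simp add: bij_betw_def h_def)
  qed
  then have "bij_betw \<sigma> (g ` vertices) (corner_numbers (cube_of c))"
    by (rule bij_betw_cong[THEN iffD1, rotated]) (simp add: \<sigma>_def)
  moreover have "\<sigma> (g v) \<in> corner_numbers (g v)" if v: "v \<in> vertices" for v
  proof -
    obtain x y z where xyz: "v = (x, y, z)"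
      by (metis surj_pair)
    have "\<sigma> (g v) = h v"
      using v inj_g by (simp add: \<sigma>_def)
    also have "\<dots> = (\<lambda>(x, y, z). corner_number ((c \<circ> \<pi> v) x) ((c \<circ> \<pi> v) y) ((c \<circ> \<pi> v) z)) v"
      using fixed v by (simp add: xyz h_def)
    also have "\<dots> \<in> corner_numbers (g v)"
      unfolding g_def corner_numbers_cube_of[OF col[OF v]] coloring_corner_numbers_def
      using v by (rule imageI)
    finally show ?thesis .
  qed
  ultimately have "\<sigma> \<in> solutions (g ` vertices) (cube_of c)"
    by (auto simp: solutions_def \<sigma>_def)
  \<comment> \<open>An infinite set has \<open>card\<close> 0, so a positive count needs finiteness
    besides the witness \<open>\<sigma>\<close>.\<close>
  moreover have "finite (solutions (g ` vertices) (cube_of c))"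
  proof (rule finite_subset)
    show "solutions (g ` vertices) (cube_of c) \<subseteq> g ` vertices \<rightarrow>\<^sub>E corner_numbers (cube_of c)"
      by (auto simp: solutions_def PiE_def bij_betw_def)
    show "finite (g ` vertices \<rightarrow>\<^sub>E corner_numbers (cube_of c))"
      using fin(1) by (intro finite_PiE) (auto simp flip: h_image)
  qed
  ultimately show "solution_number (g ` vertices) (cube_of c) > 0"
    unfolding solution_number_def by (auto simp: card_gt_0_iff)
qed

text \<open>The twist at a vertex fixes the three faces around it. When the faces with colors in \<open>A\<close> are
  \<open>Up\<close>, \<open>Right\<close>, \<open>Front\<close>, the twist moves the other three so that opposite faces are separated;
  this leaves two choices at most vertices, made here so that no two twists differ by a rotation.
  In the same way \<open>band_twist\<close> is made for the faces \<open>Right\<close>, \<open>Left\<close>, \<open>Up\<close>.\<close>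

definition vertex_twist :: "face \<times> face \<times> face \<Rightarrow> face \<Rightarrow> face" where
  "vertex_twist v = the (map_of
    [((Up, Right, Front), paint Up Left Front Down Back Right),
     ((Up, Front, Left), paint Up Back Front Down Left Right),
     ((Up, Left, Back), paint Up Down Right Back Left Front),
     ((Up, Back, Right), paint Up Left Front Back Down Right),
     ((Down, Front, Right), paint Up Down Front Left Back Right),
     ((Down, Left, Front), paint Right Down Front Back Left Up),
     ((Down, Back, Left), paint Up Down Front Back Left Right),
     ((Down, Right, Back), paint Front Down Up Back Left Right)] v)"

definition band_twist :: "face \<times> face \<times> face \<Rightarrow> face \<Rightarrow> face" where
  "band_twist v = the (map_of
    [((Up, Right, Front), paint Up Down Front Left Back Right),
     ((Up, Front, Left), paint Up Down Front Right Left Back),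
     ((Up, Left, Back), paint Up Down Right Back Left Front),
     ((Up, Back, Right), paint Up Down Left Back Front Right),
     ((Down, Front, Right), paint Left Down Front Up Back Right),
     ((Down, Left, Front), paint Right Down Front Up Left Back),
     ((Down, Back, Left), paint Right Down Up Back Left Front),
     ((Down, Right, Back), paint Left Down Up Back Front Right)] v)"

lemma bij_paint:
  fixes u d f b l r :: face
  assumes "distinct [u, d, f, b, l, r]"
  shows "bij (paint u d f b l r)"
proof -
  have "inj (paint u d f b l r)"
    using assms by (simp add: inj_def all_face eq_commute)
  then show ?thesis
    using finite_UNIV_inj_surj[OF finite_UNIV_face] by (simp add: bij_def)
qed

text \<open>By rotation invariance of \<open>map_flags\<close>, this certifies that no two of the
  eight twists differ by a rotation.\<close>

lemma vertex_twist_inj: "inj_on (\<lambda>v. map_flags (vertex_twist v)) vertices"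
  unfolding inj_on_def vertices_def flags_eq by code_simp

lemma band_twist_inj: "inj_on (\<lambda>v. map_flags (band_twist v)) vertices"
  unfolding inj_on_def vertices_def flags_eq by code_simp

text \<open>Separation of a twisted coloring depends only on which faces of \<open>c\<close> have
  colors in \<open>A\<close>, so it is checked on the eight table entries.\<close>

lemma split_solution_vertex:
  assumes c: "c \<in> colorings" and A: "c -` A = {Up, Right, Front}"
  shows "\<exists>W\<subseteq>split_cubes A. card W = 8 \<and> solution_number W (cube_of c) > 0"
proof (rule split_solution[OF c _ _ _ vertex_twist_inj])
  have mem: "c x \<in> A \<longleftrightarrow> x \<in> {Up, Right, Front}" for x
    using A by blast
  show bij: "bij (vertex_twist v)" if "v \<in> vertices" for v
    using that by (auto simp: vertices_def vertex_twist_def bij_paint)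
  show "c \<circ> vertex_twist v \<in> split_colorings A" if "v \<in> vertices" for v
    using that coloring_comp[OF c bij[OF that]]
    by (auto simp: split_colorings_def vertices_def vertex_twist_def all_face mem)
qed (auto simp: vertices_def vertex_twist_def)

lemma split_solution_band:
  assumes c: "c \<in> colorings" and A: "c -` A = {Right, Left, Up}"
  shows "\<exists>W\<subseteq>split_cubes A. card W = 8 \<and> solution_number W (cube_of c) > 0"
proof (rule split_solution[OF c _ _ _ band_twist_inj])
  have mem: "c x \<in> A \<longleftrightarrow> x \<in> {Right, Left, Up}" for x
    using A by blast
  show bij: "bij (band_twist v)" if "v \<in> vertices" for v
    using that by (auto simp: vertices_def band_twist_def bij_paint)
  show "c \<circ> band_twist v \<in> split_colorings A" if "v \<in> vertices" for v
    using that coloring_comp[OF c bij[OF that]]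
    by (auto simp: split_colorings_def vertices_def band_twist_def all_face mem)
qed (auto simp: vertices_def band_twist_def)

lemma universal_split_cubes:
  assumes "A \<subseteq> {1..6}" "card A = 3"
  shows "universal (split_cubes A)"
  unfolding universal_def
proof
  fix T assume "T \<in> macmahon_cubes"
  then obtain c where c: "c \<in> colorings" "T = cube_of c"
    by (auto simp: macmahon_cubes_eq)
  have "card (c -` A) = 3"
    using c(1) assms by (subst card_vimage_inj) (auto simp: colorings_def bij_betw_def)
  then obtain x y z where xyz: "(x, y, z) \<in> flags"
      "c -` A = {x, y, z} \<or> c -` A = {y, opposite y, x}"
    by (rule three_faces)
  obtain r where r: "r \<in> rotations" "r Up = x" "r Right = y" "r Front = z"
    using rotations_transitive[OF xyz(1)] .
  \<comment> \<open>Needed for the second case, where the opposite pair is the image of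
    \<open>Right\<close> and \<open>Left\<close>.\<close>
  have "r Left = opposite y"
    using rotation_opposite[OF r(1), of Right] r(3) by simp
  then have "c -` A = r ` {Up, Right, Front} \<or> c -` A = r ` {Right, Left, Up}"
    using xyz(2) r by simp
  then have "(c \<circ> r) -` A = {Up, Right, Front} \<or> (c \<circ> r) -` A = {Right, Left, Up}"
    using inj_vimage_image_eq[OF bij_is_inj[OF bij_rotation[OF r(1)]]]
    unfolding vimage_comp[symmetric] by metis
  moreover have cr: "c \<circ> r \<in> colorings"
    using coloring_comp[OF c(1) bij_rotation[OF r(1)]] .
  moreover have "T = cube_of (c \<circ> r)"
    unfolding c(2) using cube_of_eq_iff[OF c(1) cr] r(1) by blast
  ultimately show "\<exists>W\<subseteq>split_cubes A. card W = 8 \<and> solution_number W T > 0"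
    using split_solution_vertex split_solution_band by metis
qed

section \<open>Ten distinct universal families\<close>

theorem theorem3:
  "card {S. S \<subseteq> macmahon_cubes \<and> card S = 12 \<and> universal S} \<ge> 10"
proof -
  \<comment> \<open>A set of three colors and its complement separate the same cubes. Requiring the
    color 1 picks one set from each complementary pair, and its other two colors can be chosen in 10
    ways.\<close>
  let ?B = "{B. B \<subseteq> {2..6::nat} \<and> card B = 2}"
  let ?f = "\<lambda>B. split_cubes (insert 1 B)"
  have color_set: "insert 1 B \<subseteq> {1..6} \<and> card (insert 1 B) = 3" if "B \<in> ?B" for B
    using that finite_subset[of B "{2..6}"] by (auto simp: card_insert_if)
  have "inj_on ?f ?B"
  proof (rule inj_onI)
    fix B C assume B: "B \<in> ?B" and C: "C \<in> ?B" and eq: "?f B = ?f C"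
    \<comment> \<open>Both sides are the colors that occur opposite color 1 in the common
      family.\<close>
    have "{1..6} - insert 1 B = {1..6} - insert 1 C"
      using colors_opposite_in_split_cubes[of 1 "insert 1 B"]
        colors_opposite_in_split_cubes[of 1 "insert 1 C"] color_set[OF B] color_set[OF C] eq
      by simp
    then have "insert 1 B = insert 1 C"
      using color_set[OF B] color_set[OF C] by blast
    moreover have "1 \<notin> B" "1 \<notin> C"
      using B C by auto
    ultimately show "B = C"
      by (metis insert_ident)
  qed
  moreover have "card ?B = 10"
    using n_subsets[of "{2..6::nat}" 2] by (simp add: choose_two)
  ultimately have card_image: "card (?f ` ?B) = 10"
    by (simp add: card_image)
  have subset: "?f ` ?B \<subseteq> {S. S \<subseteq> macmahon_cubes \<and> card S = 12 \<and> universal S}"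
    using split_cubes_subset card_split_cubes universal_split_cubes color_set
    by (intro image_subsetI CollectI conjI) simp_all
  \<comment> \<open>Without finiteness the cardinality could be 0 by convention, and the ten
    families would give no lower bound.\<close>
  have finite: "finite {S. S \<subseteq> macmahon_cubes \<and> card S = 12 \<and> universal S}"
  proof -
    have "finite colorings"
      by (rule finite_subset[OF _ finite_PiE[of "UNIV :: face set" "\<lambda>_. {1..6}"]])
        (auto simp: colorings_def bij_betw_def finite_UNIV_face)
    then have "finite (Pow macmahon_cubes)"
      by (simp add: macmahon_cubes_eq)
    then show ?thesis
      by (rule rev_finite_subset) blast
  qed
  show ?thesis
    using card_mono[OF finite subset] by (simp only: card_image)
qed

end
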